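(* Let $\beta$ be a Salem number with minimal polynomial $P(x) = x^6 + ax^5 + bx^4 + cx^3 + bx^2 + ax + 1$, where $a,b,c\in\mathbb{Z}$. If $b \leq 2a - 3$, then $P(x)$ has no cyclotomic co-factor; that is, it is not the case that $\beta$ is a Parry number whose co-factor is a cyclotomic polynomial $\Phi_n(x)$ for some $n\ge1$.
   Context: A Salem number is a real algebraic integer $\beta>1$ whose other Galois conjugates all satisfy $|\alpha|\le 1$, with at least one satisfying $|\alpha|=1$. For real $\beta>1$, the greedy beta expansion $d_\beta(1)=(c_n)_{n\ge1}$ is defined by $r_0=1$, and for $n\ge 1$: $c_n=\lfloor \beta r_{n-1}\rfloor$, $r_n=\beta r_{n-1}-\lfloor \beta r_{n-1}\rfloor$. If it is eventually periodic, $\beta$ is called a Parry number, and the smallest $m\ge0$ and $p\ge1$ with $c_{n+m}=c_{n+m+p}$ for all $n\ge1$ are the preperiod length and the period length of the expansion. (By convention $p=0$ if $r_N=0$ for some $N$; this never happens for Salem numbers.) For a Salem number $\beta$ that is a Parry number with preperiod length $m$ and period length $p\geq 1$, put $P_k(x)=x^k-c_1x^{k-1}-\dots-c_k$. The companion polynomial is $R(x)=P_{m+p}(x)-P_m(x)$; it has $\beta$ as a root, so $R(x)=P(x)Q(x)$ with $P$ the minimal polynomial of $\beta$ and $Q\in\mathbb{Z}[x]$; $Q$ is the co-factor of $\beta$ (also called the co-factor of $P$). $\Phi_n$ denotes the $n$th cyclotomic polynomial. *)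

theory Defs
  imports Complex_Main "HOL-Computational_Algebra.Polynomial"
begin

definition is_minimal_poly :: "rat poly \<Rightarrow> 'a::field_char_0 \<Rightarrow> bool" where
  "is_minimal_poly p x \<longleftrightarrow>
     lead_coeff p = 1 \<and> irreducible p \<and> poly (map_poly of_rat p) x = 0"

definition galois_conjugate :: "real \<Rightarrow> complex \<Rightarrow> bool" where
  "galois_conjugate x z \<longleftrightarrow>
     (\<exists>p. is_minimal_poly p x \<and> poly (map_poly of_rat p) z = 0)"

definition salem_number :: "real \<Rightarrow> bool" where
  "salem_number \<beta> \<longleftrightarrow>
     algebraic_int \<beta> \<and> \<beta> > 1 \<and>
     (\<forall>z. galois_conjugate \<beta> z \<and> z \<noteq> complex_of_real \<beta> \<longrightarrow> cmod z \<le> 1) \<and>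
     (\<exists>z. galois_conjugate \<beta> z \<and> z \<noteq> complex_of_real \<beta> \<and> cmod z = 1)"

primrec beta_remainder :: "real \<Rightarrow> nat \<Rightarrow> real" where
  "beta_remainder \<beta> 0 = 1"
| "beta_remainder \<beta> (Suc n) =
     \<beta> * beta_remainder \<beta> n - of_int \<lfloor>\<beta> * beta_remainder \<beta> n\<rfloor>"

text \<open>Digits are indexed from 1; the value at index 0 is meaningless and never used.\<close>

definition beta_digit :: "real \<Rightarrow> nat \<Rightarrow> int" where
  "beta_digit \<beta> n = \<lfloor>\<beta> * beta_remainder \<beta> (n - 1)\<rfloor>"

definition beta_periodic :: "real \<Rightarrow> nat \<Rightarrow> nat \<Rightarrow> bool" where
  "beta_periodic \<beta> m p \<longleftrightarrow>
     p \<ge> 1 \<and> (\<forall>n\<ge>1. beta_digit \<beta> (n + m) = beta_digit \<beta> (n + m + p))"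

definition parry_number :: "real \<Rightarrow> bool" where
  "parry_number \<beta> \<longleftrightarrow> \<beta> > 1 \<and> (\<exists>m p. beta_periodic \<beta> m p)"

definition preperiod_length :: "real \<Rightarrow> nat" where
  "preperiod_length \<beta> = (LEAST m. \<exists>p. beta_periodic \<beta> m p)"

text \<open>A finite expansion has period length 0 by convention. This does not occur for
  Salem numbers.\<close>

definition period_length :: "real \<Rightarrow> nat" where
  "period_length \<beta> =
     (if \<exists>N. beta_remainder \<beta> N = 0 then 0
      else LEAST p. beta_periodic \<beta> (preperiod_length \<beta>) p)"

definition parry_partial_poly :: "real \<Rightarrow> nat \<Rightarrow> int poly" where
  "parry_partial_poly \<beta> k =
     monom 1 k - (\<Sum>i=1..k. monom (beta_digit \<beta> i) (k - i))"

text \<open>Only meaningful for Parry numbers of positive period length.\<close>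

definition companion_poly :: "real \<Rightarrow> int poly" where
  "companion_poly \<beta> =
     parry_partial_poly \<beta> (preperiod_length \<beta> + period_length \<beta>)
       - parry_partial_poly \<beta> (preperiod_length \<beta>)"

definition is_cofactor :: "real \<Rightarrow> int poly \<Rightarrow> bool" where
  "is_cofactor \<beta> Q \<longleftrightarrow>
     (\<exists>P :: int poly. is_minimal_poly (map_poly of_int P) \<beta> \<and> companion_poly \<beta> = P * Q)"

definition cyclotomic :: "nat \<Rightarrow> complex poly" where
  "cyclotomic n = (\<Prod>k\<in>{k. 1 \<le> k \<and> k \<le> n \<and> coprime k n}. [:- cis (2 * pi * real k / real n), 1:])"

end

theory Submission
  imports Defs "HOL-Computational_Algebra.Polynomial_Factorial"
    "HOL-Computational_Algebra.Field_as_Ring"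
begin

text \<open>Compare the second-highest coefficients in \<open>R = P * Q\<close>. On the left it is at most
  \<open>- \<lfloor>\<beta>\<rfloor>\<close>; on the right it is \<open>a - \<mu>(n) \<ge> a - 1\<close>, since the primitive \<open>n\<close>-th roots of unity
  sum to the Moebius function. Hence \<open>\<lfloor>\<beta>\<rfloor> \<le> 1 - a\<close>. But \<open>P\<close> has no root below \<open>-1\<close>, so
  \<open>P(-1) \<ge> 0\<close>, and together with \<open>b \<le> 2 * a - 3\<close> and \<open>P(\<beta>) = 0\<close> this forces
  \<open>- a < \<beta> - 2\<close>, contradicting \<open>\<beta> < \<lfloor>\<beta>\<rfloor> + 1\<close>.\<close>

section \<open>Minimal polynomials over the rationals\<close>

lemma map_poly_of_rat_add:
  "map_poly of_rat (p + q) = (map_poly of_rat p + map_poly of_rat q :: 'a::field_char_0 poly)"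
  by (intro poly_eqI) (simp add: coeff_map_poly of_rat_add)

lemma map_poly_of_rat_mult:
  "map_poly of_rat (p * q) = (map_poly of_rat p * map_poly of_rat q :: 'a::field_char_0 poly)"
  by (intro poly_eqI) (simp add: coeff_map_poly coeff_mult of_rat_sum of_rat_mult)

lemma map_poly_of_rat_of_int:
  "map_poly of_rat (map_poly of_int p) = (map_poly of_int p :: 'a::field_char_0 poly)"
  by (intro poly_eqI) (simp add: coeff_map_poly)

lemma map_poly_of_int_eq_iff:
  "map_poly of_int p = (map_poly of_int q :: 'a::ring_char_0 poly) \<longleftrightarrow> p = q"
  by (auto simp: poly_eq_iff coeff_map_poly)

text \<open>Otherwise \<open>p\<close> and \<open>q\<close> are coprime, and evaluating a Bezout
  identity at the common root \<open>x\<close> gives \<open>0 = 1\<close>.\<close>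

lemma is_minimal_poly_dvd:
  assumes p: "is_minimal_poly p x" and q: "poly (map_poly of_rat q) x = 0"
  shows "p dvd q"
proof (rule ccontr)
  assume "\<not> p dvd q"
  moreover have "prime_elem p"
    using p by (simp add: is_minimal_poly_def irreducible_imp_prime_elem_gcd)
  ultimately have "gcd p q = 1"
    using prime_elem_imp_coprime coprime_iff_gcd_eq_1 by blast
  then obtain u v where "u * p + v * q = 1"
    using bezout_coefficients_fst_snd[of p q] by metis
  then have "poly (map_poly of_rat (u * p + v * q)) x = 1"
    by simp
  then show False
    using p q by (simp add: is_minimal_poly_def map_poly_of_rat_add map_poly_of_rat_mult)
qed

text \<open>Identifies the factor bound existentially in \<open>is_cofactor\<close> with the given
  sextic.\<close>

lemma is_minimal_poly_unique:
  assumes "is_minimal_poly p x" "is_minimal_poly q x"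
  shows "p = q"
proof (rule associated_eqI)
  show "p dvd q" "q dvd p"
    using assms is_minimal_poly_dvd by (metis is_minimal_poly_def)+
  have "normalize f = f" if "is_minimal_poly f x" for f
    using that by (simp add: is_minimal_poly_def normalize_poly_eq_map_poly)
  then show "normalize p = p" "normalize q = q"
    using assms by simp_all
qed

section \<open>Second-highest coefficients of monic polynomials\<close>

text \<open>The second-highest coefficient of \<open>p\<close> is written \<open>coeff (reflect_poly p) 1\<close>, which
  is \<open>0\<close> for constants; \<open>coeff p (degree p - 1)\<close> would give the constant itself.\<close>

lemma coeff_1_reflect_poly_mult_monic:
  fixes p q :: "'a::idom poly"
  assumes "lead_coeff p = 1" "lead_coeff q = 1"
  shows "coeff (reflect_poly (p * q)) 1
       = coeff (reflect_poly p) 1 + coeff (reflect_poly q) 1"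
proof -
  have "coeff (reflect_poly (p * q)) 1 = (\<Sum>i\<le>1. coeff (reflect_poly p) i * coeff (reflect_poly q) (1 - i))"
    unfolding reflect_poly_mult coeff_mult ..
  also have "{..1::nat} = {0, 1}"
    by auto
  finally show ?thesis
    using assms by simp
qed

text \<open>Vieta's formula for the sum of the roots.\<close>

lemma coeff_1_reflect_poly_prod_linear:
  fixes z :: "'b \<Rightarrow> 'a::idom"
  assumes "finite A"
  shows "coeff (reflect_poly (\<Prod>k\<in>A. [:- z k, 1:])) 1 = - (\<Sum>k\<in>A. z k)"
  using assms
proof induction
  case (insert k A)
  have "lead_coeff (\<Prod>k\<in>A. [:- z k, 1:]) = 1"
    by (simp add: lead_coeff_prod)
  then have "coeff (reflect_poly ([:- z k, 1:] * (\<Prod>k\<in>A. [:- z k, 1:]))) 1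
      = - z k + coeff (reflect_poly (\<Prod>k\<in>A. [:- z k, 1:])) 1"
    by (subst coeff_1_reflect_poly_mult_monic) (simp_all add: coeff_reflect_poly[of "[:_, 1:]"])
  with insert show ?case
    by (simp del: mult_pCons_left One_nat_def)
qed simp

section \<open>Sums of primitive roots of unity\<close>

lemma sum_periodic_shift:
  fixes f :: "nat \<Rightarrow> 'a::comm_monoid_add"
  assumes "\<And>k. f (k + n) = f k"
  shows "(\<Sum>k=1..n. f (k + m)) = (\<Sum>k=1..n. f k)"
proof (induction m)
  case (Suc m)
  have "(\<Sum>k=1..n. f (k + Suc m)) = (\<Sum>k=1..n. f (k + m))"
  proof (cases "n = 0")
    case False
    have "(\<Sum>k=1..n. f (k + Suc m)) = (\<Sum>k=Suc 1..Suc n. f (k + m))"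
      unfolding sum.shift_bounds_cl_Suc_ivl by simp
    also have "\<dots> = (\<Sum>k=Suc 1..n. f (k + m)) + f (Suc n + m)"
      using False by simp
    also have "f (Suc n + m) = f (1 + m)"
      using assms[of "1 + m"] by (simp add: algebra_simps)
    also have "(\<Sum>k=Suc 1..n. f (k + m)) + f (1 + m) = (\<Sum>k=1..n. f (k + m))"
      using False by (subst (2) sum.atLeast_Suc_atMost) (auto simp: add.commute)
    finally show ?thesis .
  qed simp
  then show ?case
    using Suc by simp
qed simp

definition primitive_root_sum :: "nat \<Rightarrow> complex" where
  "primitive_root_sum n =
     (\<Sum>k\<in>{k. 1 \<le> k \<and> k \<le> n \<and> coprime k n}. cis (2 * pi * real k / real n))"

text \<open>The value is the Moebius function of \<open>n\<close>. For a prime \<open>p\<close> dividing \<open>n = p * m\<close>, the sum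
  over all \<open>k\<close> coprime to \<open>m\<close> is invariant under multiplication by a primitive \<open>p\<close>-th root
  of unity and hence vanishes; the indices not coprime to \<open>n\<close> contribute the sum for \<open>m\<close>.\<close>

lemma primitive_root_sum_cases:
  "n \<ge> 1 \<Longrightarrow> primitive_root_sum n \<in> {-1, 0, 1}"
proof (induction n rule: less_induct)
  case (less n)
  show ?case
  proof (cases "n = 1")
    case True
    then have "{k. 1 \<le> k \<and> k \<le> n \<and> coprime k n} = {1}"
      by auto
    then show ?thesis
      using True by (simp add: primitive_root_sum_def)
  next
    case False
    then obtain p where p: "prime p" "p dvd n"
      using prime_factor_nat by blast
    then obtain m where n: "n = p * m"
      by blast
    have p2: "p \<ge> 2"
      using p(1) by (rule prime_ge_2_nat)
    have m: "m \<ge> 1" "m < n"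
      using less.prems p2 by (auto simp: n Suc_le_eq)
    define e where "e k = cis (2 * pi * real k / real n)" for k
    \<comment> \<open>Extension by zero gives a function of period \<open>n\<close>, so that the sum
      may be shifted by \<open>m\<close>.\<close>
    define f where "f k = (if coprime k m then e k else 0)" for k
    have e_add: "e (j + k) = e j * e k" for j k
      by (simp add: e_def cis_mult algebra_simps add_divide_distrib)
    have "e n = 1"
      using less.prems by (simp add: e_def)
    have cop_add: "coprime (k + j * m) m \<longleftrightarrow> coprime k m" for k j
      using gcd_add_mult[of m j k] by (simp add: coprime_iff_gcd_eq_1 gcd.commute add.commute)
    have "f (k + n) = f k" for k
      using cop_add[of k p] \<open>e n = 1\<close> by (simp add: f_def e_add n)
    then have "(\<Sum>k=1..n. f k) = (\<Sum>k=1..n. f (k + m))"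
      by (rule sum_periodic_shift[symmetric])
    also have "\<dots> = (\<Sum>k=1..n. e m * f k)"
      using cop_add[of _ 1] by (intro sum.cong) (simp_all add: f_def e_add)
    also have "\<dots> = e m * (\<Sum>k=1..n. f k)"
      by (simp add: sum_distrib_left)
    finally have eq: "(\<Sum>k=1..n. f k) = e m * (\<Sum>k=1..n. f k)" .
    have "e m \<noteq> 1"
    proof
      assume "e m = 1"
      then have "cos (2 * pi / p) = 1"
        using m by (simp add: e_def n complex_eq_iff)
      moreover have "cos (2 * pi / p) < cos 0"
        \<comment> \<open>As \<open>p \<ge> 2\<close>, the angle lies in the interval from 0 to
          \<open>pi\<close>, where cosine decreases strictly.\<close>
        using p2 by (intro cos_monotone_0_pi) (auto simp: field_simps)
      ultimately show False
        by simp
    qed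
    with eq have "(\<Sum>k=1..n. f k) = 0"
      by (simp add: mult_cancel_right2)
    also have "(\<Sum>k=1..n. f k) = (\<Sum>k\<in>{k. 1 \<le> k \<and> k \<le> n \<and> coprime k m}. e k)"
      unfolding f_def by (subst sum.inter_filter[symmetric]) (auto intro: sum.cong)
    finally have zero: "(\<Sum>k\<in>{k. 1 \<le> k \<and> k \<le> n \<and> coprime k m}. e k) = 0" .
    have cop_n: "coprime k n \<longleftrightarrow> \<not> p dvd k \<and> coprime k m" for k
    proof -
      have "coprime p k \<longleftrightarrow> \<not> p dvd k"
        using p2 prime_imp_coprime[OF p(1), of k] coprime_absorb_left[of p k]
        by (cases "p dvd k") simp_all
      then show ?thesis
        by (simp add: n coprime_commute)
    qed
    show ?thesis
    proof (cases "p dvd m")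
      case True
      \<comment> \<open>Here coprimality to \<open>m\<close> already excludes the multiples of
        \<open>p\<close>.\<close>
      have "coprime k n \<longleftrightarrow> coprime k m" for k
        using True p2 coprime_common_divisor[of k m p] by (auto simp: cop_n)
      then have "primitive_root_sum n = 0"
        using zero by (simp add: primitive_root_sum_def e_def)
      then show ?thesis
        by simp
    next
      case False
      let ?A = "{k. 1 \<le> k \<and> k \<le> n \<and> coprime k n}"
      let ?B = "{k. 1 \<le> k \<and> k \<le> m \<and> coprime k m}"
      have split: "{k. 1 \<le> k \<and> k \<le> n \<and> coprime k m} = ?A \<union> (*) p ` ?B"
      proof (intro equalityI subsetI)
        fix k assume k: "k \<in> {k. 1 \<le> k \<and> k \<le> n \<and> coprime k m}"
        show "k \<in> ?A \<union> (*) p ` ?B"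
        proof (cases "p dvd k")
          case True
          then obtain j where "k = p * j"
            by blast
          with k p2 have "j \<in> ?B"
            by (auto simp: n)
          with \<open>k = p * j\<close> show ?thesis
            by blast
        next
          case False
          with k show ?thesis
            by (simp add: cop_n)
        qed
      next
        fix k assume "k \<in> ?A \<union> (*) p ` ?B"
        moreover have "coprime p m"
          using False p(1) by (rule prime_imp_coprime[rotated])
        ultimately show "k \<in> {k. 1 \<le> k \<and> k \<le> n \<and> coprime k m}"
          using p2 by (auto simp: n)
      qed
      \<comment> \<open>The factor \<open>p\<close> cancels against \<open>n = p * m\<close>,
        leaving \<open>m\<close>-th roots of unity.\<close>
      have "(\<Sum>k\<in>(*) p ` ?B. e k) = (\<Sum>k\<in>?B. e (p * k))"
        using p2 by (subst sum.reindex) (auto simp: inj_on_def)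
      also have "\<dots> = primitive_root_sum m"
        using p2 by (simp add: primitive_root_sum_def e_def n mult.assoc)
      finally have "(\<Sum>k\<in>?A \<union> (*) p ` ?B. e k) = primitive_root_sum n + primitive_root_sum m"
        by (subst sum.union_disjoint) (auto simp: cop_n primitive_root_sum_def e_def)
      with zero split have "primitive_root_sum n = - primitive_root_sum m"
        by (simp add: add_eq_0_iff2)
      with less.IH[OF m(2,1)] show ?thesis
        by auto
    qed
  qed
qed

section \<open>Coefficients of cyclotomic and companion polynomials\<close>

lemma lead_coeff_cyclotomic: "lead_coeff (cyclotomic n) = 1"
  by (simp add: cyclotomic_def lead_coeff_prod)

lemma cyclotomic_coeff_ge:
  assumes "n \<ge> 1" "map_poly of_int Q = cyclotomic n"
  shows "coeff (reflect_poly Q) 1 \<ge> -1"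
proof -
  have "coeff (reflect_poly (cyclotomic n)) 1 = - primitive_root_sum n"
    unfolding cyclotomic_def primitive_root_sum_def
    by (rule coeff_1_reflect_poly_prod_linear) simp
  moreover have "coeff (reflect_poly (map_poly of_int Q :: complex poly)) 1
      = of_int (coeff (reflect_poly Q) 1)"
    by (simp add: coeff_reflect_poly coeff_map_poly degree_map_poly)
  ultimately have "of_int (coeff (reflect_poly Q) 1) \<in> {-1, 0, 1 :: complex}"
    using primitive_root_sum_cases[OF assms(1)] assms(2) by auto
  then have "complex_of_int (coeff (reflect_poly Q) 1) \<in> of_int ` {-1, 0, 1}"
    by simp
  then show ?thesis
    by (auto simp only: of_int_eq_iff)
qed

lemma coeff_parry_partial_poly:
  "coeff (parry_partial_poly \<beta> k) j =
     (if j = k then 1 else if j < k then - beta_digit \<beta> (k - j) else 0)"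
proof -
  have "(\<Sum>i=1..k. coeff (monom (beta_digit \<beta> i) (k - i)) j)
      = (\<Sum>i=1..k. if i = k - j then (if j < k then beta_digit \<beta> i else 0) else 0)"
    by (intro sum.cong) auto
  also have "\<dots> = (if j < k then beta_digit \<beta> (k - j) else 0)"
    by (subst sum.delta) auto
  finally show ?thesis
    by (auto simp: parry_partial_poly_def coeff_sum)
qed

text \<open>The coefficient is minus the first digit if the period length exceeds 1. For period
  length 1 the leading term of the subtracted polynomial lowers it by another 1.\<close>

lemma coeff_1_reflect_companion_poly_le:
  assumes "companion_poly \<beta> \<noteq> 0"
  shows "coeff (reflect_poly (companion_poly \<beta>)) 1 \<le> - \<lfloor>\<beta>\<rfloor>"
proof -
  define m where "m = preperiod_length \<beta>"
  define p where "p = period_length \<beta>"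
  have R: "companion_poly \<beta> = parry_partial_poly \<beta> (m + p) - parry_partial_poly \<beta> m"
    by (simp add: companion_poly_def m_def p_def)
  \<comment> \<open>Period length 0 would make the companion polynomial a difference of equal
    terms.\<close>
  have "p \<noteq> 0"
    using assms R by (metis add.right_neutral diff_self)
  have deg: "degree (companion_poly \<beta>) = m + p"
  proof (rule antisym)
    show "degree (companion_poly \<beta>) \<le> m + p"
      by (rule degree_le) (simp add: R coeff_parry_partial_poly)
    show "m + p \<le> degree (companion_poly \<beta>)"
      using \<open>p \<noteq> 0\<close> by (intro le_degree) (simp add: R coeff_parry_partial_poly)
  qed
  have "coeff (reflect_poly (companion_poly \<beta>)) 1 = coeff (companion_poly \<beta>) (m + p - 1)"
    using \<open>p \<noteq> 0\<close> by (simp add: coeff_reflect_poly deg)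
  also have "\<dots> \<le> - beta_digit \<beta> 1"
  proof (cases "p = 1")
    case False
    with \<open>p \<noteq> 0\<close> have "m < m + p - 1" "m + p - 1 < m + p" "m + p - (m + p - 1) = 1"
      by auto
    then show ?thesis
      by (simp add: R coeff_parry_partial_poly)
  qed (simp add: R coeff_parry_partial_poly)
  also have "beta_digit \<beta> 1 = \<lfloor>\<beta>\<rfloor>"
    by (simp add: beta_digit_def)
  finally show ?thesis .
qed

section \<open>Inequalities for Salem sextics\<close>

text \<open>A negative value at -1 would force a real root below -1, hence a conjugate other than
  \<beta> of modulus above 1.\<close>

lemma salem_sextic_at_minus_1_nonneg:
  fixes \<beta> :: real and a b c :: int
  assumes "salem_number \<beta>" "P = [:1, a, b, c, b, a, 1:]"
    and "is_minimal_poly (map_poly of_int P) \<beta>"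
  shows "poly P (-1) \<ge> 0"
proof (rule ccontr)
  assume neg: "\<not> poly P (-1) \<ge> 0"
  define S :: "real poly" where "S = [:1, - of_int a, of_int b, - of_int c, of_int b, - of_int a, 1:]"
  have PS: "poly (map_poly of_int P) (- x) = poly S x" for x
    by (simp add: assms(2) S_def map_poly_pCons algebra_simps)
  have "poly S 1 = of_int (poly P (-1))"
    by (simp add: assms(2) S_def)
  with neg have "poly S 1 < 0"
    by simp
  obtain N where N: "\<And>x. x \<ge> N \<Longrightarrow> poly S x \<ge> lead_coeff S"
    using poly_pinfty_gt_lc[of S] by (auto simp: S_def)
  \<comment> \<open>The maximum with 2 keeps the point to the right of 1, as the intermediate value
    theorem requires.\<close>
  have "poly S (max N 2) > 0"
    using N[of "max N 2"] by (simp add: S_def)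
  then obtain x where x: "x > 1" "poly S x = 0"
    using poly_IVT_pos[of 1 "max N 2" S] \<open>poly S 1 < 0\<close> by force
  have "poly (map_poly of_int P) (complex_of_real (- x)) = complex_of_real (poly (map_poly of_int P) (- x))"
    by (simp add: assms(2) map_poly_pCons)
  then have "poly (map_poly of_int P) (complex_of_real (- x)) = 0"
    by (simp only: PS x of_real_0)
  then have "galois_conjugate \<beta> (complex_of_real (- x))"
    unfolding galois_conjugate_def using assms(3) by (metis map_poly_of_rat_of_int)
  moreover have "complex_of_real (- x) \<noteq> complex_of_real \<beta>" "cmod (complex_of_real (- x)) > 1"
    using assms(1) x(1) by (auto simp del: of_real_minus simp: salem_number_def)
  ultimately show False
    using assms(1) unfolding salem_number_def by force
qed

text \<open>With \<open>\<gamma> = \<beta> + 1/\<beta>\<close>, inserting \<open>P(-1) \<ge> 0\<close> and \<open>b \<le> 2 * a - 3\<close> into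
  \<open>P(\<beta>)/\<beta>\<^sup>3 = 0\<close> gives \<open>\<gamma> * (\<gamma> + 2) * (\<gamma> + a) \<ge> 2 * (\<gamma> + 1) * (\<gamma> + 2)\<close>.\<close>

lemma salem_sextic_trace_bound:
  fixes \<beta> a b c :: real
  assumes "\<beta> > 1" "poly [:1, a, b, c, b, a, 1:] \<beta> = 0"
    and "poly [:1, a, b, c, b, a, 1:] (-1) \<ge> 0" "b \<le> 2 * a - 3"
  shows "- a < \<beta> - 2"
proof -
  define \<gamma> where "\<gamma> = \<beta> + 1 / \<beta>"
  have pos: "\<gamma> > 0"
    using assms(1) by (simp add: \<gamma>_def add_pos_pos)
  have \<beta>\<gamma>: "\<beta> * \<gamma> = \<beta> ^ 2 + 1"
    using assms(1) by (simp add: \<gamma>_def distrib_left power2_eq_square)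
  \<comment> \<open>The cubic in \<gamma> is the trace polynomial of the reciprocal sextic;
    multiplying by \<open>\<beta> ^ 3\<close> clears denominators.\<close>
  have "\<beta> ^ 3 * (\<gamma> ^ 3 + a * \<gamma> ^ 2 + (b - 3) * \<gamma> + (c - 2 * a))
      = (\<beta> * \<gamma>) ^ 3 + a * \<beta> * (\<beta> * \<gamma>) ^ 2 + (b - 3) * \<beta> ^ 2 * (\<beta> * \<gamma>) + (c - 2 * a) * \<beta> ^ 3"
    by (simp add: algebra_simps power2_eq_square power3_eq_cube)
  also have "\<dots> = poly [:1, a, b, c, b, a, 1:] \<beta>"
    unfolding \<beta>\<gamma> by (simp add: algebra_simps power2_eq_square power3_eq_cube)
  finally have "\<beta> ^ 3 * (\<gamma> ^ 3 + a * \<gamma> ^ 2 + (b - 3) * \<gamma> + (c - 2 * a))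
      = poly [:1, a, b, c, b, a, 1:] \<beta>" .
  then have "\<gamma> ^ 3 + a * \<gamma> ^ 2 + (b - 3) * \<gamma> + (c - 2 * a) = 0"
    using assms(1,2) by auto
  \<comment> \<open>The value at -1 is \<open>2 - 2 * a + 2 * b - c\<close>.\<close>
  moreover have "c - 2 * a \<le> 2 - 4 * a + 2 * b"
    using assms(3) by simp
  ultimately have "0 \<le> \<gamma> ^ 3 + a * \<gamma> ^ 2 - 3 * \<gamma> + 2 - 4 * a + b * (\<gamma> + 2)"
    by (simp add: algebra_simps)
  also have "\<dots> \<le> \<gamma> ^ 3 + a * \<gamma> ^ 2 - 3 * \<gamma> + 2 - 4 * a + (2 * a - 3) * (\<gamma> + 2)"
    using assms(4) pos by (intro add_left_mono mult_right_mono) auto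
  also have "\<dots> = (\<gamma> + 2) * (\<gamma> * (\<gamma> + a) - 2 * (\<gamma> + 1))"
    by (simp add: algebra_simps power2_eq_square power3_eq_cube)
  finally have "2 * (\<gamma> + 1) \<le> \<gamma> * (\<gamma> + a)"
    using pos by (simp add: zero_le_mult_iff)
  then have "2 * (\<gamma> + 1) / \<gamma> \<le> \<gamma> + a"
    unfolding pos_divide_le_eq[OF pos] by (simp only: mult.commute)
  moreover have "2 * (\<gamma> + 1) / \<gamma> = 2 + 2 / \<gamma>"
    using pos by (simp add: add_divide_distrib)
  \<comment> \<open>This makes \<open>2 / \<gamma>\<close> exceed the summand
    \<open>1 / \<beta>\<close> of \<gamma>, so that a bound on \<beta> itself remains.\<close>
  moreover have "\<gamma> < 2 * \<beta>"
    using assms(1) less_trans[of "1 / \<beta>" 1 \<beta>] by (simp add: \<gamma>_def)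
  then have "2 / \<gamma> > 1 / \<beta>"
    using assms(1) pos by (simp add: divide_simps)
  ultimately show ?thesis
    by (simp add: \<gamma>_def)
qed

theorem proposition4p1:
  fixes \<beta> :: real and a b c :: int and P :: "int poly"
  assumes "salem_number \<beta>"
    and "P = [:1, a, b, c, b, a, 1:]"
    and "is_minimal_poly (map_poly of_int P) \<beta>"
    and "b \<le> 2 * a - 3"
  shows "\<not> (parry_number \<beta> \<and>
           (\<exists>n\<ge>1. \<exists>Q :: int poly. is_cofactor \<beta> Q \<and> map_poly of_int Q = cyclotomic n))"
proof
  assume "parry_number \<beta> \<and>
           (\<exists>n\<ge>1. \<exists>Q :: int poly. is_cofactor \<beta> Q \<and> map_poly of_int Q = cyclotomic n)"
  then obtain n Q where n: "n \<ge> 1"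
    and cof: "is_cofactor \<beta> Q" and Q: "map_poly of_int Q = cyclotomic n"
    by blast
  have R: "companion_poly \<beta> = P * Q"
    using cof assms(3) is_minimal_poly_unique unfolding is_cofactor_def
    by (metis map_poly_of_int_eq_iff)
  have "lead_coeff (map_poly of_int Q :: complex poly) = 1"
    by (simp add: Q lead_coeff_cyclotomic)
  then have monic_Q: "lead_coeff Q = 1"
    by (simp add: coeff_map_poly degree_map_poly)
  have monic_P: "lead_coeff P = 1"
    by (simp add: assms(2))
  have "companion_poly \<beta> \<noteq> 0"
    using R monic_P monic_Q by auto
  have "a - 1 \<le> coeff (reflect_poly P) 1 + coeff (reflect_poly Q) 1"
    using cyclotomic_coeff_ge[OF n Q] by (simp add: assms(2) coeff_reflect_poly eval_nat_numeral)
  also have "\<dots> = coeff (reflect_poly (companion_poly \<beta>)) 1"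
    using R coeff_1_reflect_poly_mult_monic[OF monic_P monic_Q] by simp
  also have "\<dots> \<le> - \<lfloor>\<beta>\<rfloor>"
    using \<open>companion_poly \<beta> \<noteq> 0\<close> by (rule coeff_1_reflect_companion_poly_le)
  finally have "\<lfloor>\<beta>\<rfloor> \<le> 1 - a"
    by simp
  then have "\<beta> < 2 - of_int a"
    by linarith
  moreover have "- of_int a < \<beta> - 2"
  proof (rule salem_sextic_trace_bound)
    show "\<beta> > 1"
      using assms(1) by (simp add: salem_number_def)
    show "poly [:1, of_int a, of_int b, of_int c, of_int b, of_int a, 1:] \<beta> = 0"
      using assms(2,3) by (simp add: is_minimal_poly_def map_poly_of_rat_of_int map_poly_pCons)
    show "poly [:1, of_int a, of_int b, of_int c, of_int b, of_int a, 1:] (-1 :: real) \<ge> 0"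
      using salem_sextic_at_minus_1_nonneg[OF assms(1-3)] by (simp add: assms(2))
    show "real_of_int b \<le> 2 * of_int a - 3"
      using assms(4) by linarith
  qed
  ultimately show False
    by simp
qed

end
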